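(* Let $(\Omega^+,\mathcal F^+,\mathbb P,\sigma)$ be a one-sided Markovian full shift over $k$ symbols, and let $\varphi$ be a strongly irreducible and spatially invertible linear random dynamical system (LRDS) acting on $\mathbb R^d$ determined by $\varphi(1,\omega)=M(\omega)$, where $M(\omega)\in GL(d,\mathbb R)$ depends only on the first coordinate $\omega_0$. Let $\psi$ be the normalized random dynamical system on $\mathbb RP^{d-1}$ induced by $\varphi$, and let $\nu$ be an invariant measure for $\psi$. Then $\nu$ is proper.
   Context: Shift: $\Omega^+=\{1,\dots,k\}^{\mathbb N}$, $\mathbb N=\{0,1,2,\dots\}$, with the $\sigma$-algebra $\mathcal F^+$ generated by cylinder sets, $(\sigma\omega)_i=\omega_{i+1}$. "One-sided Markovian full shift over $k$ symbols" means that $\mathbb P$ is a $\sigma$-invariant probability measure under which $(\omega_i)_{i\ge0}$ is a Markov chain and every non-empty cylinder set has positive probability. LRDS: $\varphi(0,\omega)=\mathrm{Id}$ and $\varphi(n,\omega)=M(\sigma^{n-1}\omega)\cdots M(\sigma\omega)M(\omega)$ for $n\ge1$. Spatially invertible means every $M(\omega)$ is invertible. The induced normalized system is $\psi(n,\omega)[x]=[\varphi(n,\omega)x]$ on $\mathbb RP^{d-1}$. Strong irreducibility: let $\mathcal S_\varphi=\{\varphi(n,\omega):n\ge0,\omega\in\Omega^+\}$. $\varphi$ is strongly irreducible if there is no non-empty finite family of nonzero proper linear subspaces $V_1,\dots,V_m$ of $\mathbb R^d$ with $A(V_1\cup\dots\cup V_m)=V_1\cup\dots\cup V_m$ for every $A\in\mathcal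 S_\varphi$. Invariant measure: a probability measure $\nu$ on $\Omega^+\times\mathbb RP^{d-1}$ whose marginal on $\Omega^+$ is $\mathbb P$ and which is invariant under the skew product $(\omega,x)\mapsto(\sigma\omega,\psi(1,\omega)x)$. It has a unique ($\mathbb P$-a.s.) factorisation $\nu(d\omega,dx)=\nu_\omega(dx)\,\mathbb P(d\omega)$. Proper: $\nu$ is proper if for every hyperplane (linear subspace of dimension $d-1$) $H$ of $\mathbb R^d$, $\int\nu_\omega(\overline H)\,\mathbb P(d\omega)=0$, where $\overline H\subset\mathbb RP^{d-1}$ is the set of lines contained in $H$. *)

theory Defs
  imports "HOL-Probability.Probability"
begin

section \<open>One-sided full shift\<close>

text \<open>The alphabet of \<open>k\<close> symbols is a finite type \<open>'k\<close>, so that the one-sided sequence space is the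
  whole type \<^typ>\<open>nat \<Rightarrow> 'k\<close>.\<close>

abbreviation seq_algebra :: "(nat \<Rightarrow> 'k::finite) measure" where
  "seq_algebra \<equiv> \<Pi>\<^sub>M i\<in>(UNIV :: nat set). count_space (UNIV :: 'k set)"

definition shift :: "(nat \<Rightarrow> 'k) \<Rightarrow> nat \<Rightarrow> 'k" where
  "shift \<omega> = (\<lambda>i. \<omega> (Suc i))"

lemma measurable_shift: "shift \<in> seq_algebra \<rightarrow>\<^sub>M seq_algebra"
  unfolding shift_def by (rule measurable_PiM_single') (auto simp: space_PiM)

text \<open>The guard on the conditioning event only matters for chains that avoid some words; it keeps
  the convention \<open>x / 0 = 0\<close> out of the Markov property.\<close>

definition markov_chain :: "(nat \<Rightarrow> 'k::finite) measure \<Rightarrow> bool" where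
  "markov_chain P \<longleftrightarrow> (\<forall>n a.
     \<P>(\<omega> in P. \<forall>i\<le>n. \<omega> i = a i) > 0 \<longrightarrow>
     \<P>(\<omega> in P. \<omega> (Suc n) = a (Suc n) \<bar> \<forall>i\<le>n. \<omega> i = a i) =
     \<P>(\<omega> in P. \<omega> (Suc n) = a (Suc n) \<bar> \<omega> n = a n))"

definition markovian_full_shift :: "(nat \<Rightarrow> 'k::finite) measure \<Rightarrow> bool" where
  "markovian_full_shift P \<longleftrightarrow>
     prob_space P \<and> sets P = sets seq_algebra \<and>
     distr P seq_algebra shift = P \<and>
     markov_chain P \<and>
     (\<forall>n a. \<P>(\<omega> in P. \<forall>i<n. \<omega> i = a i) > 0)"


section \<open>Real projective space\<close>

definition proj_space :: "(real ^ 'd::finite) set set" where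
  "proj_space = {L. subspace L \<and> dim L = 1}"

text \<open>The generators are the open sets of the quotient topology under \<open>x \<mapsto> span {x}\<close>, \<open>x \<noteq> 0\<close>.\<close>

definition proj_borel :: "(real ^ 'd::finite) set measure" where
  "proj_borel = sigma proj_space {U. U \<subseteq> proj_space \<and> open {x. x \<noteq> 0 \<and> span {x} \<in> U}}"

definition lines_in :: "(real ^ 'd::finite) set \<Rightarrow> (real ^ 'd) set set" where
  "lines_in H = {L \<in> proj_space. L \<subseteq> H}"

lemma space_proj_borel: "space proj_borel = proj_space"
  unfolding proj_borel_def by (rule space_measure_of) auto

lemma span_singleton_in_proj_space:
  assumes "x \<noteq> 0"
  shows "span {x} \<in> proj_space"
  using assms by (simp add: proj_space_def dim_span dim_singleton)

lemma lines_in_measurable: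
  fixes H :: "(real ^ 'd::finite) set"
  assumes "subspace H"
  shows "lines_in H \<in> sets proj_borel"
proof -
  have "span {x} \<subseteq> H \<longleftrightarrow> x \<in> H" for x
    using assms span_minimal[of "{x}" H] span_base[of x "{x}"] by auto
  then have "{x. x \<noteq> 0 \<and> span {x} \<in> proj_space - lines_in H} = - H"
    using subspace_0[OF assms] by (auto simp: lines_in_def intro!: span_singleton_in_proj_space)
  moreover have "open (- H)"
    using closed_subspace[OF assms] by (simp add: open_Compl)
  ultimately have "proj_space - lines_in H \<in> sets proj_borel"
    unfolding proj_borel_def by (intro in_measure_of) auto
  then have "space proj_borel - (proj_space - lines_in H) \<in> sets proj_borel"
    by (rule sets.compl_sets)
  moreover have "space proj_borel - (proj_space - lines_in H) = lines_in H"
    by (auto simp: space_proj_borel lines_in_def)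
  ultimately show ?thesis by simp
qed


section \<open>Linear random dynamical systems\<close>

primrec cocycle :: "((nat \<Rightarrow> 'k) \<Rightarrow> real ^ 'd ^ 'd) \<Rightarrow> nat \<Rightarrow> (nat \<Rightarrow> 'k) \<Rightarrow> real ^ 'd::finite ^ 'd" where
  "cocycle M 0 \<omega> = mat 1"
| "cocycle M (Suc n) \<omega> = M ((shift ^^ n) \<omega>) ** cocycle M n \<omega>"

definition spatially_invertible :: "((nat \<Rightarrow> 'k) \<Rightarrow> real ^ 'd ^ 'd::finite) \<Rightarrow> bool" where
  "spatially_invertible M \<longleftrightarrow> (\<forall>\<omega>. invertible (M \<omega>))"

definition cocycle_matrices :: "((nat \<Rightarrow> 'k) \<Rightarrow> real ^ 'd ^ 'd) \<Rightarrow> (real ^ 'd::finite ^ 'd) set" where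
  "cocycle_matrices M = {cocycle M n \<omega> | n \<omega>. True}"

definition strongly_irreducible :: "((nat \<Rightarrow> 'k) \<Rightarrow> real ^ 'd ^ 'd::finite) \<Rightarrow> bool" where
  "strongly_irreducible M \<longleftrightarrow>
     \<not> (\<exists>\<V> :: (real ^ 'd) set set. finite \<V> \<and> \<V> \<noteq> {} \<and>
          (\<forall>V\<in>\<V>. subspace V \<and> V \<noteq> {0} \<and> V \<noteq> UNIV) \<and>
          (\<forall>A\<in>cocycle_matrices M. (\<lambda>x. A *v x) ` (\<Union>\<V>) = \<Union>\<V>))"

definition proj_cocycle ::
    "((nat \<Rightarrow> 'k) \<Rightarrow> real ^ 'd ^ 'd) \<Rightarrow> nat \<Rightarrow> (nat \<Rightarrow> 'k) \<Rightarrow> (real ^ 'd::finite) set \<Rightarrow> (real ^ 'd) set" where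
  "proj_cocycle M n \<omega> L = (\<lambda>x. cocycle M n \<omega> *v x) ` L"

lemma proj_cocycle_span: "proj_cocycle M n \<omega> (span {x}) = span {cocycle M n \<omega> *v x}"
  unfolding proj_cocycle_def
  using linear_span_image[OF matrix_vector_mul_linear, of "cocycle M n \<omega>" "{x}"] by simp


section \<open>Invariant measures and properness\<close>

definition skew_product ::
    "((nat \<Rightarrow> 'k) \<Rightarrow> real ^ 'd ^ 'd) \<Rightarrow> (nat \<Rightarrow> 'k) \<times> (real ^ 'd::finite) set \<Rightarrow> (nat \<Rightarrow> 'k) \<times> (real ^ 'd) set" where
  "skew_product M = (\<lambda>(\<omega>, L). (shift \<omega>, proj_cocycle M 1 \<omega> L))"

definition invariant_measure ::
    "(nat \<Rightarrow> 'k::finite) measure \<Rightarrow> ((nat \<Rightarrow> 'k) \<Rightarrow> real ^ 'd ^ 'd) \<Rightarrow>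
     ((nat \<Rightarrow> 'k) \<times> (real ^ 'd::finite) set) measure \<Rightarrow> bool" where
  "invariant_measure P M \<nu> \<longleftrightarrow>
     prob_space \<nu> \<and> sets \<nu> = sets (seq_algebra \<Otimes>\<^sub>M proj_borel) \<and>
     distr \<nu> seq_algebra fst = P \<and>
     (\<forall>A\<in>sets \<nu>. emeasure \<nu> (skew_product M -` A \<inter> space \<nu>) = emeasure \<nu> A)"

definition factorisation ::
    "(nat \<Rightarrow> 'k::finite) measure \<Rightarrow> ((nat \<Rightarrow> 'k) \<times> (real ^ 'd::finite) set) measure \<Rightarrow>
     ((nat \<Rightarrow> 'k) \<Rightarrow> (real ^ 'd) set measure) \<Rightarrow> bool" where
  "factorisation P \<nu> \<kappa> \<longleftrightarrow>
     \<kappa> \<in> seq_algebra \<rightarrow>\<^sub>M prob_algebra proj_borel \<and>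
     (\<forall>A\<in>sets (seq_algebra \<Otimes>\<^sub>M proj_borel).
        emeasure \<nu> A = (\<integral>\<^sup>+\<omega>. \<integral>\<^sup>+L. indicator A (\<omega>, L) \<partial>\<kappa> \<omega> \<partial>P))"

text \<open>For measures \<open>\<nu>\<close> with marginal \<open>P\<close> a factorisation exists and is unique up to \<open>P\<close>-null sets, as
  both factor spaces are standard Borel; hence quantifying over all factorisations is the same as
  speaking of the factorisation.\<close>

definition proper ::
    "(nat \<Rightarrow> 'k::finite) measure \<Rightarrow> ((nat \<Rightarrow> 'k) \<times> (real ^ 'd::finite) set) measure \<Rightarrow> bool" where
  "proper P \<nu> \<longleftrightarrow>
     (\<forall>\<kappa>. factorisation P \<nu> \<kappa> \<longrightarrow>
        (\<forall>H :: (real ^ 'd) set. subspace H \<and> dim H + 1 = CARD('d) \<longrightarrow>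
           (\<integral>\<^sup>+\<omega>. emeasure (\<kappa> \<omega>) (lines_in H) \<partial>P) = 0))"

end

theory Submission
  imports Defs
begin

text \<open>
  Write \<open>f\<^sub>V(\<omega>) = \<nu>\<^sub>\<omega>(lines in V)\<close> and let \<open>l\<close> be the smallest dimension of a subspace \<open>V\<close> with
  \<open>\<integral> f\<^sub>V dP > 0\<close>. If \<open>\<nu>\<close> charged a hyperplane, \<open>l\<close> would be smaller than the dimension of the whole
  space. Two distinct \<open>l\<close>-dimensional subspaces meet in a smaller one, so the events ``the line lies in
  \<open>V\<close>'' are almost disjoint as \<open>V\<close> ranges over the \<open>l\<close>-dimensional subspaces, and their
  \<open>\<nu>\<close>-probabilities sum to at most \<open>1\<close>.

  In the classical situation of a measure stationary under a random walk on matrices, one looks at the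
  finitely many \<open>V\<close> of maximal mass: stationarity makes that family invariant. Here \<open>\<nu>\<^sub>\<omega>\<close> depends on
  the future \<open>\<omega>\<close>, and the average over the past that invariance expresses,
  \<open>f\<^sub>V(\<omega>) = \<Sum>\<^sub>j q(j, \<omega>) f\<^bsub>M\<^sub>j\<^sup>-\<^sup>1V\<^esub>(j\<omega>)\<close>, admits no maximum principle: its terms come from
  \<open>\<nu>\<close> conditioned on one more letter, and conditioning may increase the largest mass again and again.
  The way out is that the terms of this average are all equal, because it loses no energy. Indeed
  invariance gives
  \<open>\<integral> f\<^sub>V(\<sigma>\<omega>) f\<^bsub>M(\<omega>)\<^sup>-\<^sup>1V\<^esub>(\<omega>) dP = \<integral> f\<^sub>V\<^sup>2 dP\<close>, so that the square distance of the two factors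
  in the left integral is \<open>\<integral> f\<^bsub>M(\<omega>)\<^sup>-\<^sup>1V\<^esub>(\<omega>)\<^sup>2 dP - \<integral> f\<^sub>V\<^sup>2 dP\<close>. Summed over all \<open>V\<close> of dimension \<open>l\<close>
  this cancels to \<open>0\<close>, because each matrix permutes these subspaces and the sums converge. Hence
  \<open>f\<^sub>V(\<sigma>\<omega>) = f\<^bsub>M(\<omega>)\<^sup>-\<^sup>1V\<^esub>(\<omega>)\<close> almost surely (\<open>fibre_mass_equivariant\<close>).

  With this equality the direction of time can be reversed. If \<open>m\<^sub>i(V)\<close> is the \<open>\<nu>\<close>-mass of \<open>V\<close> on
  the event \<open>\<omega>\<^sub>0 = i\<close>, the Markov property turns it into
  \<open>m\<^sub>i(V) = \<Sum>\<^sub>j P(ij)/P(j) m\<^sub>j(M\<^sub>i V)\<close> (\<open>mass_on_recursion\<close>), an average for the ratios \<open>m\<^sub>i(V)/P(i)\<close>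
  with strictly positive weights. The maximum principle now applies: the finite sets of subspaces where
  this ratio is maximal are carried into each other by every \<open>M\<^sub>i\<close>, so they all coincide with one
  family that every \<open>M\<^sub>i\<close> permutes (\<open>exists_invariant_family\<close>), against strong irreducibility.
\<close>

section \<open>Stationary Markov chains seen from the future\<close>

definition cylinder :: "(nat \<Rightarrow> 'k) \<Rightarrow> nat \<Rightarrow> (nat \<Rightarrow> 'k) set" where
  "cylinder a n = {\<omega>. \<forall>m\<le>n. \<omega> m = a m}"

lemma space_seq_algebra: "space (seq_algebra :: (nat \<Rightarrow> 'k::finite) measure) = UNIV"
  by (auto simp: space_PiM PiE_def extensional_def)

lemma sets_cylinder [measurable]: "cylinder (a :: nat \<Rightarrow> 'k::finite) n \<in> sets seq_algebra"
proof -
  have "{\<omega> \<in> space seq_algebra. \<forall>m\<in>{..n}. \<omega> m = a m} \<in> sets (seq_algebra :: (nat \<Rightarrow> 'k) measure)"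
    by measurable
  then show ?thesis by (simp add: cylinder_def space_seq_algebra atMost_def)
qed

text \<open>Cylinders of one fixed length partition the sequence space into finitely many pieces, and every
  generator of the product \<open>\<sigma>\<close>-algebra is a union of such pieces.\<close>

lemma measure_eqI_cylinders:
  fixes Q R :: "(nat \<Rightarrow> 'k::finite) measure"
  assumes sets: "sets Q = sets seq_algebra" "sets R = sets seq_algebra"
    and fin: "finite_measure Q"
    and eq: "\<And>a n. emeasure Q (cylinder a n) = emeasure R (cylinder a n)"
  shows "Q = R"
proof (rule measure_eqI_PiM_infinite[OF sets _ fin])
  fix A :: "nat \<Rightarrow> 'k set" and J :: "nat set"
  assume J: "finite J"
  then obtain n where n: "J \<subseteq> {..n}"
    by (metis finite_nat_set_iff_bounded_le atMost_iff subsetI)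
  define W where "W = {a \<in> PiE {..n} (\<lambda>_. UNIV). \<forall>j\<in>J. a j \<in> A j}"
  have W: "finite W"
    unfolding W_def by (rule finite_subset[OF _ finite_PiE[of "{..n}" "\<lambda>_. UNIV"]]) auto
  have emb: "prod_emb UNIV (\<lambda>_. count_space UNIV) J (Pi\<^sub>E J A) = (\<Union>a\<in>W. cylinder a n)"
  proof (intro set_eqI iffI)
    fix \<omega> assume "\<omega> \<in> prod_emb UNIV (\<lambda>_. count_space UNIV) J (Pi\<^sub>E J A)"
    then have "restrict \<omega> {..n} \<in> W"
      using n by (auto simp: W_def prod_emb_def PiE_iff)
    moreover have "\<omega> \<in> cylinder (restrict \<omega> {..n}) n"
      by (auto simp: cylinder_def)
    ultimately show "\<omega> \<in> (\<Union>a\<in>W. cylinder a n)" by blast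
  next
    fix \<omega> assume "\<omega> \<in> (\<Union>a\<in>W. cylinder a n)"
    then show "\<omega> \<in> prod_emb UNIV (\<lambda>_. count_space UNIV) J (Pi\<^sub>E J A)"
      using n by (auto simp: W_def prod_emb_def cylinder_def PiE_iff subset_eq)
  qed
  have disj: "disjoint_family_on (\<lambda>a. cylinder a n) W"
    unfolding disjoint_family_on_def
  proof (intro ballI impI equals0I)
    fix a b \<omega> assume ab: "a \<in> W" "b \<in> W" "a \<noteq> b" and "\<omega> \<in> cylinder a n \<inter> cylinder b n"
    then have "a m = b m" if "m \<in> {..n}" for m
      using that by (auto simp: cylinder_def)
    then have "a = b"
      using ab by (intro PiE_ext[of a "{..n}" "\<lambda>_. UNIV" b]) (auto simp: W_def)
    with ab show False by simp
  qed
  have "emeasure Q (\<Union>a\<in>W. cylinder a n) = (\<Sum>a\<in>W. emeasure Q (cylinder a n))"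
    using W disj by (intro sum_emeasure[symmetric]) (auto simp: sets)
  also have "\<dots> = (\<Sum>a\<in>W. emeasure R (cylinder a n))"
    by (simp add: eq)
  also have "\<dots> = emeasure R (\<Union>a\<in>W. cylinder a n)"
    using W disj by (intro sum_emeasure) (auto simp: sets)
  finally show "emeasure Q (prod_emb UNIV (\<lambda>_. count_space UNIV) J (Pi\<^sub>E J A)) =
      emeasure R (prod_emb UNIV (\<lambda>_. count_space UNIV) J (Pi\<^sub>E J A))"
    by (simp add: emb)
qed

locale markov_shift =
  fixes P :: "(nat \<Rightarrow> 'k::finite) measure"
  assumes full_shift: "markovian_full_shift P"
begin

sublocale prob_space P
  using full_shift by (simp add: markovian_full_shift_def)

lemma sets_P [measurable_cong]: "sets P = sets seq_algebra"
  using full_shift by (simp add: markovian_full_shift_def)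

lemma space_P: "space P = UNIV"
  using sets_eq_imp_space_eq[OF sets_P] by (simp add: space_seq_algebra)

lemma measurable_shift_P [measurable]: "shift \<in> P \<rightarrow>\<^sub>M P"
  using measurable_shift by (simp add: measurable_cong_sets[OF sets_P sets_P])

lemma distr_shift: "distr P P shift = P"
proof -
  have "distr P P shift = distr P seq_algebra shift"
    by (rule distr_cong) (auto simp: sets_P)
  then show ?thesis
    using full_shift by (simp add: markovian_full_shift_def)
qed

lemma integral_shift:
  fixes f :: "(nat \<Rightarrow> 'k) \<Rightarrow> real"
  assumes [measurable]: "f \<in> borel_measurable P"
  shows "(\<integral>\<omega>. f (shift \<omega>) \<partial>P) = (\<integral>\<omega>. f \<omega> \<partial>P)"
  by (subst (2) distr_shift[symmetric]) (simp add: integral_distr)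

lemma prob_shift: "A \<in> sets P \<Longrightarrow> prob (shift -` A) = prob A"
  by (subst (2) distr_shift[symmetric]) (simp add: measure_distr space_P)

lemma coordinate_measurable [measurable]: "(\<lambda>\<omega>. \<omega> n) \<in> P \<rightarrow>\<^sub>M count_space UNIV"
  by (simp add: measurable_cong_sets[OF sets_P refl])

lemma sets_coordinate: "{\<omega>. \<omega> n = j} \<in> sets P" "{\<omega>. \<omega> n = j \<and> \<omega> m = j'} \<in> sets P"
proof -
  have "{\<omega> \<in> space P. \<omega> n = j} \<in> sets P" "{\<omega> \<in> space P. \<omega> n = j \<and> \<omega> m = j'} \<in> sets P"
    by measurable
  then show "{\<omega>. \<omega> n = j} \<in> sets P" "{\<omega>. \<omega> n = j \<and> \<omega> m = j'} \<in> sets P"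
    by (simp_all add: space_P)
qed

text \<open>By stationarity the laws of one letter and of two consecutive letters do not depend on the time,
  so time \<open>0\<close> stands for all of them.\<close>

definition letter_prob :: "'k \<Rightarrow> real" where
  "letter_prob j = prob {\<omega>. \<omega> 0 = j}"

definition pair_prob :: "'k \<Rightarrow> 'k \<Rightarrow> real" where
  "pair_prob i j = prob {\<omega>. \<omega> 0 = i \<and> \<omega> 1 = j}"

lemma prob_coordinate: "prob {\<omega>. \<omega> n = j} = letter_prob j"
proof (induction n)
  case (Suc n)
  have "{\<omega>. \<omega> (Suc n) = j} = shift -` {\<omega>. \<omega> n = j}"
    by (auto simp: shift_def)
  with Suc prob_shift[OF sets_coordinate(1)] show ?case by simp
qed (simp add: letter_prob_def)

lemma prob_coordinate_pair: "prob {\<omega>. \<omega> n = i \<and> \<omega> (Suc n) = j} = pair_prob i j"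
proof (induction n)
  case (Suc n)
  have "{\<omega>. \<omega> (Suc n) = i \<and> \<omega> (Suc (Suc n)) = j} = shift -` {\<omega>. \<omega> n = i \<and> \<omega> (Suc n) = j}"
    by (auto simp: shift_def)
  with Suc prob_shift[OF sets_coordinate(2)] show ?case by simp
qed (simp add: pair_prob_def)

lemma prob_cylinder_pos: "prob (cylinder a n) > 0"
proof -
  have "prob {\<omega> \<in> space P. \<forall>i<Suc n. \<omega> i = a i} > 0"
    using full_shift unfolding markovian_full_shift_def by blast
  then show ?thesis by (simp add: space_P cylinder_def less_Suc_eq_le)
qed

lemma letter_prob_pos: "letter_prob j > 0"
  using prob_cylinder_pos[of "\<lambda>_. j" 0] by (simp add: letter_prob_def cylinder_def)

lemma pair_prob_pos: "pair_prob i j > 0"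
proof -
  have "cylinder (\<lambda>m. if m = 0 then i else j) 1 = {\<omega>. \<omega> 0 = i \<and> \<omega> 1 = j}"
    by (auto simp: cylinder_def le_Suc_eq)
  then show ?thesis
    using prob_cylinder_pos[of "\<lambda>m. if m = 0 then i else j" 1] by (simp add: pair_prob_def)
qed

lemma prob_cylinder_Suc:
  "prob (cylinder a (Suc n)) * letter_prob (a n) = prob (cylinder a n) * pair_prob (a n) (a (Suc n))"
proof -
  have "prob {\<omega> \<in> space P. \<forall>i\<le>n. \<omega> i = a i} > 0"
    using prob_cylinder_pos[of a n] by (simp add: cylinder_def space_P)
  then have "\<P>(\<omega> in P. \<omega> (Suc n) = a (Suc n) \<bar> \<forall>i\<le>n. \<omega> i = a i) =
      \<P>(\<omega> in P. \<omega> (Suc n) = a (Suc n) \<bar> \<omega> n = a n)"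
    using full_shift unfolding markovian_full_shift_def markov_chain_def by blast
  moreover have "{\<omega>. \<omega> (Suc n) = a (Suc n) \<and> (\<forall>i\<le>n. \<omega> i = a i)} = cylinder a (Suc n)"
    by (auto simp: cylinder_def le_Suc_eq)
  moreover have "{\<omega>. \<omega> (Suc n) = a (Suc n) \<and> \<omega> n = a n} = {\<omega>. \<omega> n = a n \<and> \<omega> (Suc n) = a (Suc n)}"
    by auto
  moreover have "{\<omega>. \<forall>i\<le>n. \<omega> i = a i} = cylinder a n"
    by (simp add: cylinder_def)
  ultimately have "prob (cylinder a (Suc n)) / prob (cylinder a n) =
      pair_prob (a n) (a (Suc n)) / letter_prob (a n)"
    by (simp add: cond_prob_def space_P prob_coordinate prob_coordinate_pair)
  then show ?thesis
    using prob_cylinder_pos[of a n] letter_prob_pos[of "a n"] by (simp add: field_simps)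
qed

text \<open>Prepending a letter multiplies the probability of a cylinder by a factor that depends only on that
  letter and the next one: this is the Markov property of the time-reversed chain. It follows from the
  forward property because extending the word at its far end multiplies both sides by the same
  transition probability.\<close>

lemma prob_cylinder_prepend:
  "prob ({\<omega>. \<omega> 0 = i} \<inter> shift -` cylinder b n) * letter_prob (b 0) =
     pair_prob i (b 0) * prob (cylinder b n)"
proof -
  have cyl: "{\<omega>. \<omega> 0 = i} \<inter> shift -` cylinder b n = cylinder (case_nat i b) (Suc n)" for n
  proof (intro set_eqI iffI)
    fix \<omega> assume "\<omega> \<in> {\<omega>. \<omega> 0 = i} \<inter> shift -` cylinder b n"
    then show "\<omega> \<in> cylinder (case_nat i b) (Suc n)"
      by (auto simp: cylinder_def shift_def split: nat.split)
  next
    fix \<omega> assume \<omega>: "\<omega> \<in> cylinder (case_nat i b) (Suc n)"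
    then have "\<omega> (Suc m) = b m" if "m \<le> n" for m
      using that by (auto simp: cylinder_def dest!: spec[of _ "Suc m"])
    moreover have "\<omega> 0 = i"
      using \<omega> by (auto simp: cylinder_def)
    ultimately show "\<omega> \<in> {\<omega>. \<omega> 0 = i} \<inter> shift -` cylinder b n"
      by (auto simp: cylinder_def shift_def)
  qed
  show ?thesis unfolding cyl
  proof (induction n)
    case 0
    have "cylinder (case_nat i b) (Suc 0) = {\<omega>. \<omega> 0 = i \<and> \<omega> 1 = b 0}"
      by (auto simp: cylinder_def le_Suc_eq)
    moreover have "cylinder b 0 = {\<omega>. \<omega> 0 = b 0}"
      by (auto simp: cylinder_def)
    ultimately show ?case by (simp add: pair_prob_def letter_prob_def)
  next
    case (Suc n)
    let ?c = "case_nat i b"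
    have 1: "prob (cylinder ?c (Suc (Suc n))) * letter_prob (b n) =
        prob (cylinder ?c (Suc n)) * pair_prob (b n) (b (Suc n))"
      using prob_cylinder_Suc[of ?c "Suc n"] by simp
    have 2: "prob (cylinder b (Suc n)) * letter_prob (b n) =
        prob (cylinder b n) * pair_prob (b n) (b (Suc n))"
      by (rule prob_cylinder_Suc)
    have "(prob (cylinder ?c (Suc (Suc n))) * letter_prob (b 0)) * letter_prob (b n) =
        (prob (cylinder ?c (Suc n)) * letter_prob (b 0)) * pair_prob (b n) (b (Suc n))"
      using 1 by (simp add: ac_simps)
    also have "\<dots> = (pair_prob i (b 0) * prob (cylinder b (Suc n))) * letter_prob (b n)"
      using 2 Suc by (simp add: ac_simps)
    finally show ?case
      using letter_prob_pos[of "b n"] by simp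
  qed
qed

lemma integrable_indicator_letter:
  fixes f :: "(nat \<Rightarrow> 'k) \<Rightarrow> real"
  shows "integrable P f \<Longrightarrow> integrable P (\<lambda>\<omega>. indicator {\<omega>. \<omega> 0 = j} \<omega> * f \<omega>)"
  using integrable_mult_indicator[OF sets_coordinate(1)[of 0 j], of f] by simp

lemma integral_first_letter_split:
  fixes g :: "'k \<Rightarrow> (nat \<Rightarrow> 'k) \<Rightarrow> real"
  assumes "\<And>j. integrable P (g j)"
  shows "(\<integral>\<omega>. g (\<omega> 0) \<omega> \<partial>P) = (\<Sum>j\<in>UNIV. \<integral>\<omega>. indicator {\<omega>. \<omega> 0 = j} \<omega> * g j \<omega> \<partial>P)"
proof -
  have "(\<integral>\<omega>. g (\<omega> 0) \<omega> \<partial>P) = (\<integral>\<omega>. (\<Sum>j\<in>UNIV. indicator {\<omega>. \<omega> 0 = j} \<omega> * g j \<omega>) \<partial>P)"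
    by (rule Bochner_Integration.integral_cong) (auto simp: indicator_def if_distrib sum.delta cong: if_cong)
  also have "\<dots> = (\<Sum>j\<in>UNIV. \<integral>\<omega>. indicator {\<omega>. \<omega> 0 = j} \<omega> * g j \<omega> \<partial>P)"
    using assms by (intro Bochner_Integration.integral_sum integrable_indicator_letter)
  finally show ?thesis .
qed

text \<open>Conditioned on the future from time \<open>1\<close> on, the first letter is \<open>i\<close> with the backward transition
  probability \<open>pair_prob i j / letter_prob j\<close>, where \<open>j\<close> is the letter at time \<open>1\<close>. Shifting turns
  that letter into the one at time \<open>0\<close>, over which the sum runs.\<close>

lemma integral_prepend:
  fixes g :: "(nat \<Rightarrow> 'k) \<Rightarrow> real"
  assumes g: "integrable P g"
  shows "(\<integral>\<omega>. indicator {\<omega>. \<omega> 0 = i} \<omega> * g (shift \<omega>) \<partial>P) =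
    (\<Sum>j\<in>UNIV. pair_prob i j / letter_prob j * (\<integral>\<omega>. indicator {\<omega>. \<omega> 0 = j} \<omega> * g \<omega> \<partial>P))"
proof -
  have [measurable]: "g \<in> borel_measurable P" "{\<omega>. \<omega> 0 = i} \<in> sets P"
    using g sets_coordinate by auto
  define r where "r j = pair_prob i j / letter_prob j" for j
  have r: "r j \<ge> 0" for j
    using pair_prob_pos[of i j] letter_prob_pos[of j] by (simp add: r_def)
  have [measurable]: "(\<lambda>\<omega>. r (\<omega> 0)) \<in> borel_measurable P"
    by (rule measurable_compose[OF coordinate_measurable]) simp
  let ?Q = "distr (density P (\<lambda>\<omega>. ennreal (indicator {\<omega>. \<omega> 0 = i} \<omega>))) P shift"
  let ?R = "density P (\<lambda>\<omega>. ennreal (r (\<omega> 0)))"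
  have "?Q = ?R"
  proof (rule measure_eqI_cylinders)
    show "finite_measure ?Q"
    proof (rule finite_measure.finite_measure_distr[OF finite_measureI])
      let ?D = "density P (\<lambda>\<omega>. ennreal (indicator {\<omega>. \<omega> 0 = i} \<omega>))"
      have "emeasure ?D (space ?D) =
          (\<integral>\<^sup>+\<omega>. ennreal (indicator {\<omega>. \<omega> 0 = i} \<omega>) * indicator (space P) \<omega> \<partial>P)"
        by (subst emeasure_density) auto
      also have "\<dots> \<le> (\<integral>\<^sup>+\<omega>. 1 \<partial>P)"
        by (rule nn_integral_mono) (auto simp: indicator_def)
      finally show "emeasure ?D (space ?D) \<noteq> \<infinity>"
        by (auto simp: emeasure_space_1 top_unique)
    qed simp
    fix a n
    have [measurable]: "cylinder a n \<in> sets P"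
      by (simp add: sets_P)
    let ?B = "shift -` cylinder a n"
    have [measurable]: "?B \<in> sets P"
      using measurable_sets[OF measurable_shift_P, of "cylinder a n"] by (simp add: space_P sets_P)
    have "emeasure ?Q (cylinder a n) =
        emeasure (density P (\<lambda>\<omega>. ennreal (indicator {\<omega>. \<omega> 0 = i} \<omega>))) ?B"
      by (simp add: emeasure_distr space_P)
    also have "\<dots> = (\<integral>\<^sup>+\<omega>. ennreal (indicator {\<omega>. \<omega> 0 = i} \<omega>) * indicator ?B \<omega> \<partial>P)"
      by (subst emeasure_density) auto
    also have "\<dots> = (\<integral>\<^sup>+\<omega>. indicator ({\<omega>. \<omega> 0 = i} \<inter> ?B) \<omega> \<partial>P)"
      by (intro nn_integral_cong) (auto simp: indicator_def)
    also have "\<dots> = prob ({\<omega>. \<omega> 0 = i} \<inter> ?B)"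
      by (subst nn_integral_indicator) (auto simp: emeasure_eq_measure)
    also have "prob ({\<omega>. \<omega> 0 = i} \<inter> shift -` cylinder a n) = r (a 0) * prob (cylinder a n)"
      using prob_cylinder_prepend[of i a n] letter_prob_pos[of "a 0"]
      by (simp add: r_def field_simps)
    also have "ennreal \<dots> = (\<integral>\<^sup>+\<omega>. ennreal (r (a 0)) * indicator (cylinder a n) \<omega> \<partial>P)"
      using r by (simp add: nn_integral_cmult_indicator emeasure_eq_measure ennreal_mult)
    also have "\<dots> = (\<integral>\<^sup>+\<omega>. ennreal (r (\<omega> 0)) * indicator (cylinder a n) \<omega> \<partial>P)"
      by (intro nn_integral_cong) (auto simp: indicator_def cylinder_def)
    also have "\<dots> = emeasure ?R (cylinder a n)"
      by (rule emeasure_density[symmetric]) measurable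
    finally show "emeasure ?Q (cylinder a n) = emeasure ?R (cylinder a n)" .
  qed (simp_all add: sets_P)
  have "(\<integral>\<omega>. indicator {\<omega>. \<omega> 0 = i} \<omega> * g (shift \<omega>) \<partial>P) = (\<integral>\<omega>. g \<omega> \<partial>?Q)"
    by (simp add: integral_distr integral_density)
  also have "\<dots> = (\<integral>\<omega>. r (\<omega> 0) * g \<omega> \<partial>P)"
    unfolding \<open>?Q = ?R\<close> using r by (simp add: integral_density)
  also have "\<dots> = (\<Sum>j\<in>UNIV. \<integral>\<omega>. indicator {\<omega>. \<omega> 0 = j} \<omega> * (r j * g \<omega>) \<partial>P)"
    by (rule integral_first_letter_split) (simp add: g)
  also have "\<dots> = (\<Sum>j\<in>UNIV. r j * (\<integral>\<omega>. indicator {\<omega>. \<omega> 0 = j} \<omega> * g \<omega> \<partial>P))"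
    by (intro sum.cong refl) (simp add: mult.left_commute)
  finally show ?thesis by (simp add: r_def)
qed

text \<open>The case of a constant integrand: after division by \<open>letter_prob i\<close> the weights of
  \<open>integral_prepend\<close> against \<open>letter_prob\<close> have total mass \<open>1\<close>, as the maximum principle requires.\<close>

lemma letter_prob_prepend: "(\<Sum>j\<in>UNIV. pair_prob i j / letter_prob j * letter_prob j) = letter_prob i"
  using integral_prepend[of "\<lambda>_. 1" i] sets_coordinate by (simp add: letter_prob_def)

end

section \<open>Subspaces under invertible matrices\<close>

lemma invertible_bij:
  fixes A :: "real ^ 'd ^ 'd::finite"
  assumes "invertible A"
  shows "bij ((*v) A)"
  using assms by (metis bijI inj_matrix_vector_mult invertible_def matrix_vector_mul_assoc matrix_vector_mul_lid surjI)

definition subspaces_of_dim :: "nat \<Rightarrow> (real ^ 'd::finite) set set" where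
  "subspaces_of_dim l = {V. subspace V \<and> dim V = l}"

lemma image_subspaces_of_dim:
  fixes A :: "real ^ 'd ^ 'd::finite"
  assumes "invertible A" "V \<in> subspaces_of_dim l"
  shows "(*v) A ` V \<in> subspaces_of_dim l"
proof -
  have "inj_on ((*v) A) (span V)"
    using invertible_bij[OF assms(1)] by (simp add: bij_def inj_on_subset[OF _ subset_UNIV])
  then have "dim ((*v) A ` V) = dim V"
    by (rule dim_image_eq[OF matrix_vector_mul_linear])
  then show ?thesis
    using assms(2) linear_subspace_image[OF matrix_vector_mul_linear, of V A]
    by (simp add: subspaces_of_dim_def)
qed

lemma vimage_subspaces_of_dim:
  fixes A :: "real ^ 'd ^ 'd::finite"
  assumes A: "invertible A" and V: "V \<in> subspaces_of_dim l"
  shows "(*v) A -` V \<in> subspaces_of_dim l"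
proof -
  obtain B where B: "A ** B = mat 1" "B ** A = mat 1"
    using A by (auto simp: invertible_def)
  then have "(*v) A -` V = (*v) B ` V"
    by (force simp: matrix_vector_mul_assoc image_iff)
  moreover have "invertible B"
    using B by (auto simp: invertible_def)
  ultimately show ?thesis
    using image_subspaces_of_dim V by metis
qed

lemma bij_betw_vimage_subspaces_of_dim:
  fixes A :: "real ^ 'd ^ 'd::finite"
  assumes A: "invertible A"
  shows "bij_betw (\<lambda>V. (*v) A -` V) (subspaces_of_dim l) (subspaces_of_dim l)"
proof (rule bij_betw_byWitness[where f' = "\<lambda>V. (*v) A ` V"])
  have "bij ((*v) A)"
    by (rule invertible_bij[OF A])
  then show "\<forall>V\<in>subspaces_of_dim l. (*v) A ` ((*v) A -` V) = V"
    and "\<forall>V\<in>subspaces_of_dim l. (*v) A -` ((*v) A ` V) = V"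
    by (auto simp: bij_def surj_image_vimage_eq inj_vimage_image_eq)
qed (use image_subspaces_of_dim[OF A] vimage_subspaces_of_dim[OF A] in auto)

lemma lines_in_Int: "lines_in V \<inter> lines_in W = lines_in (V \<inter> W)"
  by (auto simp: lines_in_def)

lemma image_mem_proj_space:
  fixes A :: "real ^ 'd ^ 'd::finite"
  assumes "invertible A" "L \<in> proj_space"
  shows "(*v) A ` L \<in> proj_space"
  using image_subspaces_of_dim[OF assms(1), of L 1] assms(2)
  by (simp add: subspaces_of_dim_def proj_space_def)

lemma image_mem_lines_in:
  fixes A :: "real ^ 'd ^ 'd::finite"
  assumes "invertible A" "L \<in> proj_space"
  shows "(*v) A ` L \<in> lines_in V \<longleftrightarrow> L \<in> lines_in ((*v) A -` V)"
  using image_mem_proj_space[OF assms] assms(2) by (auto simp: lines_in_def)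

lemma dim_Int_less:
  fixes V W :: "(real ^ 'd::finite) set"
  assumes "V \<in> subspaces_of_dim l" "W \<in> subspaces_of_dim l" "V \<noteq> W"
  shows "dim (V \<inter> W) < l"
proof (rule ccontr)
  assume "\<not> dim (V \<inter> W) < l"
  then have le: "dim V \<le> dim (V \<inter> W)" "dim W \<le> dim (V \<inter> W)"
    and sub: "subspace V" "subspace W"
    using assms by (auto simp: subspaces_of_dim_def)
  have "V \<inter> W = V"
    by (rule subspace_dim_equal[OF subspace_inter[OF sub] sub(1) _ le(1)]) simp
  moreover have "V \<inter> W = W"
    by (rule subspace_dim_equal[OF subspace_inter[OF sub] sub(2) _ le(2)]) simp
  ultimately have "V = W" by simp
  with assms(3) show False by simp
qed

lemma lines_in_dim_0:
  assumes "dim V = 0"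
  shows "lines_in V = {}"
proof -
  have "dim L \<noteq> 1" if "L \<subseteq> V" for L
    using dim_subset[OF that] assms by linarith
  then show ?thesis by (auto simp: lines_in_def proj_space_def)
qed

section \<open>Disintegrated invariant measures\<close>

locale disintegrated_system = markov_shift P
  for P :: "(nat \<Rightarrow> 'k::finite) measure" +
  fixes M :: "(nat \<Rightarrow> 'k) \<Rightarrow> real ^ 'd ^ 'd::finite"
    and \<nu> :: "((nat \<Rightarrow> 'k) \<times> (real ^ 'd) set) measure"
    and \<kappa> :: "(nat \<Rightarrow> 'k) \<Rightarrow> (real ^ 'd) set measure"
  assumes first_coordinate: "\<And>\<omega> \<omega>'. \<omega> 0 = \<omega>' 0 \<Longrightarrow> M \<omega> = M \<omega>'"
    and invertible_M: "spatially_invertible M"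
    and invariant: "invariant_measure P M \<nu>"
    and factorisation: "factorisation P \<nu> \<kappa>"
begin

definition generator :: "'k \<Rightarrow> real ^ 'd ^ 'd" where
  "generator j = M (\<lambda>_. j)"

lemma M_eq_generator: "M \<omega> = generator (\<omega> 0)"
  unfolding generator_def by (rule first_coordinate) simp

lemma invertible_generator: "invertible (generator j)"
  using invertible_M by (simp add: generator_def spatially_invertible_def)

abbreviation pull :: "'k \<Rightarrow> (real ^ 'd) set \<Rightarrow> (real ^ 'd) set" where
  "pull j V \<equiv> (*v) (generator j) -` V"

abbreviation push :: "'k \<Rightarrow> (real ^ 'd) set \<Rightarrow> (real ^ 'd) set" where
  "push j V \<equiv> (*v) (generator j) ` V"

lemma pull_push: "pull j (push j V) = V"
  using invertible_bij[OF invertible_generator] by (simp add: bij_def inj_vimage_image_eq)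

lemma subspace_pull: "subspace V \<Longrightarrow> subspace (pull j V)"
  by (rule linear_subspace_vimage[OF matrix_vector_mul_linear])

definition fibre_mass :: "(real ^ 'd) set \<Rightarrow> (nat \<Rightarrow> 'k) \<Rightarrow> real" where
  "fibre_mass V \<omega> = measure (\<kappa> \<omega>) (lines_in V)"

lemma prob_space_kernel: "prob_space (\<kappa> \<omega>)"
  and sets_kernel: "sets (\<kappa> \<omega>) = sets proj_borel"
proof -
  have "\<kappa> \<omega> \<in> space (prob_algebra proj_borel)"
    using factorisation unfolding factorisation_def
    by (auto dest!: measurable_space simp: space_seq_algebra)
  then show "prob_space (\<kappa> \<omega>)" "sets (\<kappa> \<omega>) = sets proj_borel"
    by (simp_all add: space_prob_algebra)
qed

lemma fibre_mass_nonneg: "0 \<le> fibre_mass V \<omega>"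
  by (simp add: fibre_mass_def)

lemma fibre_mass_le_1: "fibre_mass V \<omega> \<le> 1"
  unfolding fibre_mass_def using prob_space_kernel by (rule prob_space.prob_le_1)

lemma emeasure_kernel_lines: "emeasure (\<kappa> \<omega>) (lines_in V) = ennreal (fibre_mass V \<omega>)"
  unfolding fibre_mass_def
  by (intro finite_measure.emeasure_eq_measure prob_space.finite_measure prob_space_kernel)

lemma measurable_fibre_mass:
  assumes "subspace V"
  shows "fibre_mass V \<in> borel_measurable P"
proof -
  have "\<kappa> \<in> seq_algebra \<rightarrow>\<^sub>M subprob_algebra proj_borel"
    using factorisation by (auto simp: factorisation_def intro: measurable_prob_algebraD)
  from measurable_compose[OF this measurable_measure_subprob_algebra[OF lines_in_measurable[OF assms]]]
  show ?thesis
    by (simp add: fibre_mass_def[abs_def] measurable_cong_sets[OF sets_P refl])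
qed

lemma measurable_fibre_mass_pull:
  assumes V: "subspace V"
  shows "(\<lambda>\<omega>. fibre_mass (pull (\<omega> 0) V) \<omega>) \<in> borel_measurable P"
  by (rule measurable_compose_countable[OF measurable_fibre_mass[OF subspace_pull[OF V]]
        coordinate_measurable])

lemma bounded_integrable:
  fixes f :: "(nat \<Rightarrow> 'k) \<Rightarrow> real"
  shows "f \<in> borel_measurable P \<Longrightarrow> (\<And>\<omega>. 0 \<le> f \<omega>) \<Longrightarrow> (\<And>\<omega>. f \<omega> \<le> 1) \<Longrightarrow> integrable P f"
  by (rule integrable_const_bound[where B = 1]) auto

lemma integrable_fibre_mass: "subspace V \<Longrightarrow> integrable P (fibre_mass V)"
  by (intro bounded_integrable measurable_fibre_mass fibre_mass_nonneg fibre_mass_le_1)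

lemma sets_nu: "sets \<nu> = sets (seq_algebra \<Otimes>\<^sub>M proj_borel)"
  using invariant by (simp add: invariant_measure_def)

lemma space_nu: "space \<nu> = UNIV \<times> proj_space"
  using sets_eq_imp_space_eq[OF sets_nu]
  by (simp add: space_pair_measure space_seq_algebra space_proj_borel)

lemma rectangle_mem_sets:
  "A \<in> sets P \<Longrightarrow> subspace V \<Longrightarrow> A \<times> lines_in V \<in> sets (seq_algebra \<Otimes>\<^sub>M proj_borel)"
  by (intro pair_measureI lines_in_measurable) (simp_all add: sets_P)

text \<open>The subspace may vary with \<open>\<omega>\<close>, since the preimage of a rectangle under the skew product has
  this form.\<close>

lemma emeasure_fibred_lines:
  assumes sets: "{(\<omega>, L). \<omega> \<in> A \<and> L \<in> lines_in (W \<omega>)} \<in> sets (seq_algebra \<Otimes>\<^sub>M proj_borel)"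
    and W: "\<And>\<omega>. subspace (W \<omega>)"
  shows "emeasure \<nu> {(\<omega>, L). \<omega> \<in> A \<and> L \<in> lines_in (W \<omega>)} =
    (\<integral>\<^sup>+\<omega>. ennreal (fibre_mass (W \<omega>) \<omega>) * indicator A \<omega> \<partial>P)"
proof -
  let ?X = "{(\<omega>, L). \<omega> \<in> A \<and> L \<in> lines_in (W \<omega>)}"
  have "emeasure \<nu> ?X = (\<integral>\<^sup>+\<omega>. \<integral>\<^sup>+L. indicator ?X (\<omega>, L) \<partial>\<kappa> \<omega> \<partial>P)"
    using factorisation sets by (simp add: factorisation_def)
  also have "\<dots> = (\<integral>\<^sup>+\<omega>. ennreal (fibre_mass (W \<omega>) \<omega>) * indicator A \<omega> \<partial>P)"
  proof (rule nn_integral_cong)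
    fix \<omega>
    have "(\<integral>\<^sup>+L. indicator ?X (\<omega>, L) \<partial>\<kappa> \<omega>) = (\<integral>\<^sup>+L. indicator A \<omega> * indicator (lines_in (W \<omega>)) L \<partial>\<kappa> \<omega>)"
      by (rule nn_integral_cong) (simp add: indicator_def)
    also have "\<dots> = indicator A \<omega> * emeasure (\<kappa> \<omega>) (lines_in (W \<omega>))"
      using lines_in_measurable[OF W] by (simp add: nn_integral_cmult_indicator sets_kernel)
    finally show "(\<integral>\<^sup>+L. indicator ?X (\<omega>, L) \<partial>\<kappa> \<omega>) = ennreal (fibre_mass (W \<omega>) \<omega>) * indicator A \<omega>"
      by (simp add: emeasure_kernel_lines mult.commute)
  qed
  finally show ?thesis .
qed

lemma emeasure_rectangle:
  assumes "A \<in> sets P" "subspace V"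
  shows "emeasure \<nu> (A \<times> lines_in V) = (\<integral>\<^sup>+\<omega>. ennreal (fibre_mass V \<omega>) * indicator A \<omega> \<partial>P)"
proof -
  have "A \<times> lines_in V = {(\<omega>, L). \<omega> \<in> A \<and> L \<in> lines_in V}"
    by auto
  then show ?thesis
    using emeasure_fibred_lines[of A "\<lambda>_. V"] rectangle_mem_sets[OF assms] assms by simp
qed

lemma skew_product_vimage:
  "skew_product M -` (A \<times> lines_in V) \<inter> space \<nu> =
    {(\<omega>, L). \<omega> \<in> shift -` A \<and> L \<in> lines_in (pull (\<omega> 0) V)}"
proof -
  have "proj_cocycle M 1 \<omega> L = (*v) (generator (\<omega> 0)) ` L" for \<omega> L
    by (simp add: proj_cocycle_def M_eq_generator)
  moreover have "L \<in> proj_space" if "L \<in> lines_in W" for L W :: "(real ^ 'd) set"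
    using that by (simp add: lines_in_def)
  ultimately show ?thesis
    using image_mem_lines_in[OF invertible_generator]
    by (auto simp: skew_product_def space_nu)
qed

text \<open>Invariance of \<open>\<nu>\<close> tested on the rectangle \<open>A \<times> lines_in V\<close>.\<close>

lemma fibre_mass_transport:
  assumes A: "A \<in> sets P" and V: "subspace V"
  shows "(\<integral>\<^sup>+\<omega>. ennreal (fibre_mass V \<omega>) * indicator A \<omega> \<partial>P) =
    (\<integral>\<^sup>+\<omega>. ennreal (fibre_mass (pull (\<omega> 0) V) \<omega>) * indicator (shift -` A) \<omega> \<partial>P)"
proof -
  have shA: "shift -` A \<in> sets P"
    using measurable_sets[OF measurable_shift_P A] by (simp add: space_P)
  have "{(\<omega>, L). \<omega> \<in> shift -` A \<and> L \<in> lines_in (pull (\<omega> 0) V)} =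
      (\<Union>j. (shift -` A \<inter> {\<omega>. \<omega> 0 = j}) \<times> lines_in (pull j V))"
    by auto
  also have "\<dots> \<in> sets (seq_algebra \<Otimes>\<^sub>M proj_borel)"
    by (intro sets.finite_UN finite rectangle_mem_sets sets.Int shA sets_coordinate subspace_pull V)
  finally have X: "{(\<omega>, L). \<omega> \<in> shift -` A \<and> L \<in> lines_in (pull (\<omega> 0) V)} \<in> \<dots>" .
  have "emeasure \<nu> (A \<times> lines_in V) = emeasure \<nu> (skew_product M -` (A \<times> lines_in V) \<inter> space \<nu>)"
    using invariant rectangle_mem_sets[OF A V] by (simp add: invariant_measure_def)
  then show ?thesis
    unfolding emeasure_rectangle[OF A V] skew_product_vimage
      emeasure_fibred_lines[OF X subspace_pull[OF V]] .
qed

text \<open>Invariance says that the shift carries the measure with density \<open>fibre_mass (pull (\<omega> 0) V) \<omega>\<close> to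
  the one with density \<open>fibre_mass V\<close>. Taking \<open>fibre_mass V\<close> itself as test function \<open>g\<close> evaluates
  the mixed term of the square in \<open>pull_defect\<close>.\<close>

lemma integral_fibre_mass_transport:
  fixes g :: "(nat \<Rightarrow> 'k) \<Rightarrow> real"
  assumes V: "subspace V" and g [measurable]: "g \<in> borel_measurable P"
  shows "(\<integral>\<omega>. fibre_mass V \<omega> * g \<omega> \<partial>P) =
    (\<integral>\<omega>. fibre_mass (pull (\<omega> 0) V) \<omega> * g (shift \<omega>) \<partial>P)"
proof -
  note [measurable] = measurable_fibre_mass[OF V] measurable_fibre_mass_pull[OF V]
  have "density P (\<lambda>\<omega>. ennreal (fibre_mass V \<omega>)) =
      distr (density P (\<lambda>\<omega>. ennreal (fibre_mass (pull (\<omega> 0) V) \<omega>))) P shift" (is "?Q = ?R")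
  proof (rule measure_eqI)
    fix A assume "A \<in> sets ?Q"
    then have [measurable]: "A \<in> sets P" by simp
    have [measurable]: "shift -` A \<in> sets P"
      using measurable_sets[OF measurable_shift_P, of A] by (simp add: space_P)
    have "emeasure ?Q A = (\<integral>\<^sup>+\<omega>. ennreal (fibre_mass V \<omega>) * indicator A \<omega> \<partial>P)"
      by (subst emeasure_density) auto
    also have "\<dots> = (\<integral>\<^sup>+\<omega>. ennreal (fibre_mass (pull (\<omega> 0) V) \<omega>) * indicator (shift -` A) \<omega> \<partial>P)"
      by (rule fibre_mass_transport[OF _ V]) simp
    also have "\<dots> = emeasure (density P (\<lambda>\<omega>. ennreal (fibre_mass (pull (\<omega> 0) V) \<omega>))) (shift -` A)"
      by (subst emeasure_density) auto
    also have "\<dots> = emeasure ?R A"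
      by (simp add: emeasure_distr space_P)
    finally show "emeasure ?Q A = emeasure ?R A" .
  qed simp
  then have "(\<integral>\<omega>. g \<omega> \<partial>?Q) = (\<integral>\<omega>. g \<omega> \<partial>?R)"
    by simp
  then show ?thesis
    by (simp add: integral_density integral_distr fibre_mass_nonneg)
qed

end

section \<open>Energy and equivariance of the fibre masses\<close>

lemma has_sum_sum:
  fixes h :: "'j \<Rightarrow> 'v \<Rightarrow> real"
  assumes "finite J" "\<And>j. j \<in> J \<Longrightarrow> (h j has_sum s j) S"
  shows "((\<lambda>v. \<Sum>j\<in>J. h j v) has_sum (\<Sum>j\<in>J. s j)) S"
  using assms by (induction J rule: finite_induct) (auto intro: has_sum_add)

lemma has_sum_diff:
  fixes f g :: "'v \<Rightarrow> real"
  assumes "(f has_sum a) S" "(g has_sum b) S"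
  shows "((\<lambda>v. f v - g v) has_sum (a - b)) S"
  using has_sum_add[OF assms(1), of "\<lambda>v. - g v" "- b"] assms(2) by (simp add: has_sum_uminus)

context disintegrated_system
begin

definition mass :: "(real ^ 'd) set \<Rightarrow> real" where
  "mass V = (\<integral>\<omega>. fibre_mass V \<omega> \<partial>P)"

definition mass_on :: "'k \<Rightarrow> (real ^ 'd) set \<Rightarrow> real" where
  "mass_on j V = (\<integral>\<omega>. indicator {\<omega>. \<omega> 0 = j} \<omega> * fibre_mass V \<omega> \<partial>P)"

lemma mass_nonneg: "0 \<le> mass V"
  unfolding mass_def by (intro integral_nonneg_AE AE_I2 fibre_mass_nonneg)

lemma mass_on_nonneg: "0 \<le> mass_on j V"
  unfolding mass_on_def by (intro integral_nonneg_AE AE_I2) (simp add: fibre_mass_nonneg)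

lemma nn_integral_fibre_mass:
  assumes "subspace V"
  shows "(\<integral>\<^sup>+\<omega>. ennreal (fibre_mass V \<omega>) \<partial>P) = ennreal (mass V)"
  unfolding mass_def
  by (intro nn_integral_eq_integral integrable_fibre_mass assms AE_I2 fibre_mass_nonneg)

lemma emeasure_lines:
  assumes V: "subspace V"
  shows "emeasure \<nu> (UNIV \<times> lines_in V) = ennreal (mass V)"
proof -
  have "UNIV \<in> sets P"
    using sets.top[of P] by (simp add: space_P)
  from emeasure_rectangle[OF this V] show ?thesis
    by (simp add: nn_integral_fibre_mass[OF V])
qed

lemma mass_eq_sum_mass_on:
  assumes "subspace V"
  shows "mass V = (\<Sum>j\<in>UNIV. mass_on j V)"
  unfolding mass_def mass_on_def
  using integral_first_letter_split[of "\<lambda>_. fibre_mass V"] integrable_fibre_mass[OF assms] by simp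

lemma mass_on_le_mass: "subspace V \<Longrightarrow> mass_on j V \<le> mass V"
  unfolding mass_eq_sum_mass_on by (rule member_le_sum) (auto simp: mass_on_nonneg)

lemma integrable_fibre_mass_prod:
  assumes "subspace V" "subspace W"
  shows "integrable P (\<lambda>\<omega>. fibre_mass V \<omega> * fibre_mass W \<omega>)"
  using assms
  by (intro bounded_integrable borel_measurable_times measurable_fibre_mass mult_nonneg_nonneg
      mult_le_one fibre_mass_nonneg fibre_mass_le_1)

text \<open>Restricting to a letter makes the matrix constant, so that sums over subspaces can be
  reindexed by \<open>pull j\<close>.\<close>

definition energy_on :: "'k \<Rightarrow> (real ^ 'd) set \<Rightarrow> real" where
  "energy_on j V = (\<integral>\<omega>. indicator {\<omega>. \<omega> 0 = j} \<omega> * (fibre_mass V \<omega> * fibre_mass V \<omega>) \<partial>P)"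

lemma energy_on_nonneg: "0 \<le> energy_on j V"
  unfolding energy_on_def by (intro integral_nonneg_AE AE_I2) (simp add: fibre_mass_nonneg)

lemma energy_on_le_mass:
  assumes V: "subspace V"
  shows "energy_on j V \<le> mass V"
  unfolding energy_on_def mass_def
proof (rule integral_mono)
  fix \<omega>
  have "fibre_mass V \<omega> * fibre_mass V \<omega> \<le> fibre_mass V \<omega> * 1"
    by (intro mult_left_mono fibre_mass_le_1 fibre_mass_nonneg)
  then show "indicator {\<omega>. \<omega> 0 = j} \<omega> * (fibre_mass V \<omega> * fibre_mass V \<omega>) \<le> fibre_mass V \<omega>"
    using fibre_mass_nonneg[of V \<omega>] by (simp add: indicator_def)
qed (intro integrable_indicator_letter integrable_fibre_mass_prod integrable_fibre_mass V)+

text \<open>The mixed term of the square equals \<open>\<integral> (fibre_mass V)\<^sup>2\<close> by invariance of \<open>\<nu>\<close>, and so does the square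
  of the shifted function by invariance of \<open>P\<close>. The mixed term counts twice, which leaves one copy with a
  minus sign.\<close>

lemma pull_defect:
  assumes V: "subspace V"
  defines "\<delta> \<equiv> \<lambda>\<omega>. fibre_mass V (shift \<omega>) - fibre_mass (pull (\<omega> 0) V) \<omega>"
  shows "integrable P (\<lambda>\<omega>. \<delta> \<omega> * \<delta> \<omega>)"
    and "(\<integral>\<omega>. \<delta> \<omega> * \<delta> \<omega> \<partial>P) = (\<Sum>j\<in>UNIV. energy_on j (pull j V)) - (\<Sum>j\<in>UNIV. energy_on j V)"
proof -
  let ?f = "\<lambda>\<omega>. fibre_mass V \<omega>" and ?s = "\<lambda>\<omega>. fibre_mass V (shift \<omega>)"
    and ?g = "\<lambda>\<omega>. fibre_mass (pull (\<omega> 0) V) \<omega>"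
  note meas = measurable_compose[OF measurable_shift_P measurable_fibre_mass[OF V]]
    measurable_fibre_mass_pull[OF V]
  have int: "integrable P (\<lambda>\<omega>. ?s \<omega> * ?s \<omega>)" "integrable P (\<lambda>\<omega>. ?g \<omega> * ?g \<omega>)"
    "integrable P (\<lambda>\<omega>. ?g \<omega> * ?s \<omega>)"
    by (intro bounded_integrable borel_measurable_times meas mult_nonneg_nonneg mult_le_one
        fibre_mass_nonneg fibre_mass_le_1)+
  have sq: "\<delta> \<omega> * \<delta> \<omega> = ?s \<omega> * ?s \<omega> + ?g \<omega> * ?g \<omega> - 2 * (?g \<omega> * ?s \<omega>)" for \<omega>
    by (simp add: \<delta>_def algebra_simps)
  show "integrable P (\<lambda>\<omega>. \<delta> \<omega> * \<delta> \<omega>)"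
    unfolding sq using int by auto
  have energy: "(\<integral>\<omega>. ?f \<omega> * ?f \<omega> \<partial>P) = (\<Sum>j\<in>UNIV. energy_on j V)"
    unfolding energy_on_def
    using integral_first_letter_split[of "\<lambda>_ \<omega>. ?f \<omega> * ?f \<omega>"] integrable_fibre_mass_prod[OF V V]
    by simp
  have "(\<integral>\<omega>. ?s \<omega> * ?s \<omega> \<partial>P) = (\<Sum>j\<in>UNIV. energy_on j V)"
    using integral_shift[of "\<lambda>\<omega>. ?f \<omega> * ?f \<omega>"] measurable_fibre_mass[OF V] by (simp add: energy)
  moreover have "(\<integral>\<omega>. ?g \<omega> * ?s \<omega> \<partial>P) = (\<Sum>j\<in>UNIV. energy_on j V)"
    using integral_fibre_mass_transport[OF V measurable_fibre_mass[OF V]] by (simp add: energy)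
  moreover have "(\<integral>\<omega>. ?g \<omega> * ?g \<omega> \<partial>P) = (\<Sum>j\<in>UNIV. energy_on j (pull j V))"
    unfolding energy_on_def
    using integral_first_letter_split[of "\<lambda>j \<omega>. fibre_mass (pull j V) \<omega> * fibre_mass (pull j V) \<omega>"]
      integrable_fibre_mass_prod[OF subspace_pull[OF V] subspace_pull[OF V]]
    by simp
  ultimately show "(\<integral>\<omega>. \<delta> \<omega> * \<delta> \<omega> \<partial>P) =
      (\<Sum>j\<in>UNIV. energy_on j (pull j V)) - (\<Sum>j\<in>UNIV. energy_on j V)"
    unfolding sq using int by simp
qed

end

text \<open>Any two distinct subspaces of dimension \<open>l\<close> share no mass in this setting, which is what makes the
  masses of all of them summable.\<close>

locale minimal_charged_dimension = disintegrated_system +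
  fixes l :: nat
  assumes null_below: "\<And>V. subspace V \<Longrightarrow> dim V < l \<Longrightarrow> mass V = 0"
begin

abbreviation \<S> :: "(real ^ 'b) set set" where
  "\<S> \<equiv> subspaces_of_dim l"

lemma subspace_\<S>: "V \<in> \<S> \<Longrightarrow> subspace V"
  by (simp add: subspaces_of_dim_def)

lemma sum_mass_le_1:
  assumes F: "finite F" "F \<subseteq> \<S>"
  shows "(\<Sum>V\<in>F. mass V) \<le> 1"
proof -
  interpret \<nu>: prob_space \<nu>
    using invariant by (simp add: invariant_measure_def)
  have sets: "UNIV \<times> lines_in V \<in> sets \<nu>" if "subspace V" for V
    using rectangle_mem_sets[OF _ that, of UNIV] sets.top[of P] by (simp add: space_P sets_nu)
  have mass: "mass V = \<nu>.prob (UNIV \<times> lines_in V)" if "V \<in> F" for V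
    using emeasure_lines[of V] that F subspace_\<S>
    by (auto simp: \<nu>.emeasure_eq_measure mass_nonneg)
  have "pairwise (\<lambda>V W. AE x in \<nu>. x \<notin> UNIV \<times> lines_in V \<or> x \<notin> UNIV \<times> lines_in W) F"
  proof (rule pairwiseI)
    fix V W assume "V \<in> F" "W \<in> F" "V \<noteq> W"
    then have VW: "V \<in> \<S>" "W \<in> \<S>" "V \<noteq> W"
      using F by auto
    then have sub: "subspace (V \<inter> W)"
      by (intro subspace_inter subspace_\<S>)
    have "mass (V \<inter> W) = 0"
      using dim_Int_less[OF VW] by (rule null_below[OF sub])
    then have "UNIV \<times> lines_in (V \<inter> W) \<in> null_sets \<nu>"
      using emeasure_lines[OF sub] sets[OF sub] by auto
    then have "AE x in \<nu>. x \<notin> UNIV \<times> lines_in (V \<inter> W)"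
      by (rule AE_not_in)
    then show "AE x in \<nu>. x \<notin> UNIV \<times> lines_in V \<or> x \<notin> UNIV \<times> lines_in W"
      by eventually_elim (auto simp: lines_in_Int[symmetric])
  qed
  then have "\<nu>.prob (\<Union>V\<in>F. UNIV \<times> lines_in V) = (\<Sum>V\<in>F. \<nu>.prob (UNIV \<times> lines_in V))"
    using F sets subspace_\<S> by (intro measure_UNION_AE) (auto simp: \<nu>.fmeasurable_eq_sets)
  then have "(\<Sum>V\<in>F. mass V) = \<nu>.prob (\<Union>V\<in>F. UNIV \<times> lines_in V)"
    by (simp add: mass)
  then show ?thesis by simp
qed

lemma summable_mass: "mass summable_on \<S>"
proof (rule nonneg_bdd_above_summable_on)
  show "bdd_above (sum mass ` {F. F \<subseteq> \<S> \<and> finite F})"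
    using sum_mass_le_1 by (intro bdd_aboveI[of _ 1]) auto
qed (rule mass_nonneg)

lemma finite_mass_ge:
  assumes "\<epsilon> > 0"
  shows "finite {V \<in> \<S>. mass V \<ge> \<epsilon>}"
proof (rule ccontr)
  assume inf: "infinite {V \<in> \<S>. mass V \<ge> \<epsilon>}"
  obtain n :: nat where n: "real n * \<epsilon> > 1"
    using reals_Archimedean3[OF assms] by blast
  obtain F where F: "F \<subseteq> {V \<in> \<S>. mass V \<ge> \<epsilon>}" "finite F" "card F = n"
    using infinite_arbitrarily_large[OF inf] by blast
  have "real n * \<epsilon> \<le> (\<Sum>V\<in>F. mass V)"
    using sum_bounded_below[of F \<epsilon> mass] F by auto
  with sum_mass_le_1[of F] F n show False by auto
qed

text \<open>The mean square defect of \<open>V\<close> is nonnegative and, by \<open>pull_defect\<close>, a difference of two terms that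
  are rearrangements of one another when \<open>V\<close> runs through all subspaces of dimension \<open>l\<close>. The total of
  the defects is therefore \<open>0\<close>, and each of them vanishes. Infinite sums over the uncountable set of
  subspaces are harmless, since only numbers, never functions, are summed over it.\<close>

theorem fibre_mass_equivariant:
  assumes V: "V \<in> \<S>"
  shows "AE \<omega> in P. fibre_mass V (shift \<omega>) = fibre_mass (pull (\<omega> 0) V) \<omega>"
proof -
  define D where "D V = (\<Sum>j\<in>UNIV. energy_on j (pull j V) - energy_on j V)" for V
  have D: "D V = (\<integral>\<omega>. (fibre_mass V (shift \<omega>) - fibre_mass (pull (\<omega> 0) V) \<omega>) *
      (fibre_mass V (shift \<omega>) - fibre_mass (pull (\<omega> 0) V) \<omega>) \<partial>P)" if "V \<in> \<S>" for V
    using pull_defect(2)[OF subspace_\<S>[OF that]] by (simp add: D_def sum_subtractf)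
  have "energy_on j summable_on \<S>" for j
    using summable_mass
    by (rule summable_on_comparison_test) (auto intro: energy_on_le_mass energy_on_nonneg subspace_\<S>)
  then have energy: "(energy_on j has_sum infsum (energy_on j) \<S>) \<S>" for j
    by (rule has_sum_infsum)
  have pulled: "((\<lambda>V. energy_on j (pull j V)) has_sum infsum (energy_on j) \<S>) \<S>" for j
    using energy by (simp add: has_sum_reindex_bij_betw[OF
        bij_betw_vimage_subspaces_of_dim[OF invertible_generator]])
  have "((\<lambda>V. energy_on j (pull j V) - energy_on j V) has_sum 0) \<S>" for j
    using has_sum_diff[OF pulled[of j] energy[of j]] by simp
  from has_sum_sum[OF finite this] have "(D has_sum 0) \<S>"
    by (simp add: D_def[abs_def])
  then have "D V = 0"
    using V by (intro nonneg_infsum_le_0D[of D \<S>])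
      (auto simp: D infsumI has_sum_imp_summable)
  then have "AE \<omega> in P. (fibre_mass V (shift \<omega>) - fibre_mass (pull (\<omega> 0) V) \<omega>) *
      (fibre_mass V (shift \<omega>) - fibre_mass (pull (\<omega> 0) V) \<omega>) = 0"
    using integral_nonneg_eq_0_iff_AE[OF pull_defect(1)[OF subspace_\<S>[OF V]]] D[OF V] by simp
  then show ?thesis
    by eventually_elim simp
qed

text \<open>On \<open>\<omega> 0 = i\<close> equivariance replaces the fibre mass of \<open>V\<close> at \<open>\<omega>\<close> by that of \<open>push i V\<close> at
  \<open>shift \<omega>\<close>. The integrand is then the indicator of the first letter times a function of
  \<open>shift \<omega>\<close>, and \<open>integral_prepend\<close> integrates out the first letter.\<close>

lemma mass_on_recursion:
  assumes V: "V \<in> \<S>"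
  shows "mass_on i V = (\<Sum>j\<in>UNIV. pair_prob i j / letter_prob j * mass_on j (push i V))"
proof -
  have W: "push i V \<in> \<S>"
    by (rule image_subspaces_of_dim[OF invertible_generator V])
  note [measurable] = measurable_fibre_mass[OF subspace_\<S>[OF W]] measurable_fibre_mass[OF subspace_\<S>[OF V]]
    sets_coordinate(1)[of 0 i]
  have "mass_on i V = (\<integral>\<omega>. indicator {\<omega>. \<omega> 0 = i} \<omega> * fibre_mass (push i V) (shift \<omega>) \<partial>P)"
    unfolding mass_on_def
  proof (rule integral_cong_AE)
    show "AE \<omega> in P. indicator {\<omega>. \<omega> 0 = i} \<omega> * fibre_mass V \<omega> =
        indicator {\<omega>. \<omega> 0 = i} \<omega> * fibre_mass (push i V) (shift \<omega>)"
      using fibre_mass_equivariant[OF W] by eventually_elim (auto simp: indicator_def pull_push)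
  qed measurable
  also have "\<dots> = (\<Sum>j\<in>UNIV. pair_prob i j / letter_prob j * mass_on j (push i V))"
    unfolding mass_on_def by (rule integral_prepend[OF integrable_fibre_mass[OF subspace_\<S>[OF W]]])
  finally show ?thesis .
qed

text \<open>Maximum principle. With \<open>c\<close> the largest value of \<open>mass_on i V / letter_prob i\<close>, the recursion
  exhibits this ratio at \<open>(i, V)\<close> as an average, with positive weights, of the ratios at
  \<open>(j, push i V)\<close>. So \<open>push i\<close> maps the maximisers for the letter \<open>i\<close> injectively into those for every letter
  \<open>j\<close>; comparing cardinalities, these finite sets are all equal.\<close>

lemma exists_invariant_family:
  assumes V\<^sub>0: "V\<^sub>0 \<in> \<S>" "mass V\<^sub>0 > 0"
  obtains Z where "finite Z" "Z \<noteq> {}" "Z \<subseteq> \<S>" "\<And>V. V \<in> Z \<Longrightarrow> mass V > 0"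
    "\<And>i. push i ` Z = Z"
proof -
  define ratio where "ratio i V = mass_on i V / letter_prob i" for i V
  obtain i\<^sub>0 where i\<^sub>0: "mass_on i\<^sub>0 V\<^sub>0 > 0"
    using V\<^sub>0 mass_eq_sum_mass_on[OF subspace_\<S>[OF V\<^sub>0(1)]] sum_nonpos[of UNIV "\<lambda>j. mass_on j V\<^sub>0"]
    by (metis not_less)
  define \<epsilon> where "\<epsilon> = ratio i\<^sub>0 V\<^sub>0"
  have \<epsilon>: "\<epsilon> > 0"
    using i\<^sub>0 letter_prob_pos by (simp add: \<epsilon>_def ratio_def)
  \<comment> \<open>A supremum over infinitely many subspaces is attained because only finitely many pairs reach
    the positive value \<open>\<epsilon>\<close>.\<close>
  define K where "K = {(i, V). V \<in> \<S> \<and> ratio i V \<ge> \<epsilon>}"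
  have "finite K"
  proof (rule finite_subset)
    show "K \<subseteq> (\<Union>i\<in>UNIV. {i} \<times> {V \<in> \<S>. mass V \<ge> \<epsilon> * letter_prob i})"
    proof
      fix x assume "x \<in> K"
      then obtain i V where x: "x = (i, V)" "V \<in> \<S>" "\<epsilon> * letter_prob i \<le> mass_on i V"
        using letter_prob_pos by (auto simp: K_def ratio_def pos_le_divide_eq)
      with mass_on_le_mass[OF subspace_\<S>, of V i]
      show "x \<in> (\<Union>i\<in>UNIV. {i} \<times> {V \<in> \<S>. mass V \<ge> \<epsilon> * letter_prob i})" by auto
    qed
  qed (auto intro!: finite_mass_ge simp: \<epsilon> letter_prob_pos)
  moreover have "(i\<^sub>0, V\<^sub>0) \<in> K"
    using V\<^sub>0 by (simp add: K_def \<epsilon>_def)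
  ultimately have fin: "finite (case_prod ratio ` K)" "case_prod ratio ` K \<noteq> {}"
    by auto
  obtain i\<^sub>1 V\<^sub>1 where K1: "(i\<^sub>1, V\<^sub>1) \<in> K" "Max (case_prod ratio ` K) = ratio i\<^sub>1 V\<^sub>1"
    using Max_in[OF fin] by (metis (no_types, lifting) case_prod_conv imageE surj_pair)
  have max: "ratio i V \<le> ratio i\<^sub>1 V\<^sub>1" if "(i, V) \<in> K" for i V
    using Max_ge[OF fin(1) imageI[OF that]] K1(2) by simp
  define c where "c = ratio i\<^sub>1 V\<^sub>1"
  have c: "c \<ge> \<epsilon>"
    using K1 by (simp add: c_def K_def)
  have ratio_le: "ratio i V \<le> c" if "V \<in> \<S>" for i V
  proof (cases "ratio i V \<ge> \<epsilon>")
    case True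
    with that max[of i V] show ?thesis by (simp add: K_def c_def)
  qed (use c in simp)
  have mass_on_le: "mass_on i V \<le> c * letter_prob i" if "V \<in> \<S>" for i V
    using ratio_le[OF that, of i] letter_prob_pos[of i] by (simp add: ratio_def pos_divide_le_eq)
  define Z where "Z i = {V \<in> \<S>. mass_on i V = c * letter_prob i}" for i
  have Z_eq_K: "V \<in> Z i \<Longrightarrow> (i, V) \<in> K" for i V
    using c letter_prob_pos[of i] by (auto simp: Z_def K_def ratio_def)
  have "Z i \<subseteq> snd ` K" for i
    using Z_eq_K by force
  then have finite_Z: "finite (Z i)" for i
    using \<open>finite K\<close> by (meson finite_imageI finite_subset)
  have push_Z: "push i ` Z i \<subseteq> Z j" for i j
  proof (rule image_subsetI)
    fix V assume V: "V \<in> Z i"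
    then have VS: "V \<in> \<S>" by (simp add: Z_def)
    have W: "push i V \<in> \<S>"
      by (rule image_subspaces_of_dim[OF invertible_generator VS])
    let ?w = "\<lambda>j. pair_prob i j / letter_prob j"
    have "(\<Sum>j\<in>UNIV. ?w j * (c * letter_prob j - mass_on j (push i V))) =
        c * (\<Sum>j\<in>UNIV. ?w j * letter_prob j) - (\<Sum>j\<in>UNIV. ?w j * mass_on j (push i V))"
      by (simp only: right_diff_distrib sum_subtractf sum_distrib_left mult.left_commute)
    also have "\<dots> = c * letter_prob i - mass_on i V"
      by (simp only: letter_prob_prepend mass_on_recursion[OF VS])
    also have "\<dots> = 0"
      using V by (simp add: Z_def)
    finally have sum0: "(\<Sum>j\<in>UNIV. ?w j * (c * letter_prob j - mass_on j (push i V))) = 0" .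
    have w: "?w j > 0" for j
      using pair_prob_pos letter_prob_pos by simp
    have "?w j * (c * letter_prob j - mass_on j (push i V)) \<ge> 0" for j
      using w[of j] mass_on_le[OF W, of j] by (intro mult_nonneg_nonneg) auto
    then have "?w j * (c * letter_prob j - mass_on j (push i V)) = 0" for j
      by (intro sum_nonneg_0[OF finite _ sum0 UNIV_I])
    then have "c * letter_prob j - mass_on j (push i V) = 0"
      using w[of j] by (metis less_irrefl mult_eq_0_iff)
    then have "mass_on j (push i V) = c * letter_prob j"
      by simp
    with W show "push i V \<in> Z j" by (simp add: Z_def)
  qed
  have inj: "inj_on (push i) (Z i)" for i
    by (rule inj_on_inverseI[where g = "pull i"]) (rule pull_push)
  have card_le: "card (Z i) \<le> card (Z j)" for i j
    using card_inj_on_le[OF inj push_Z finite_Z] .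
  have push_eq: "push i ` Z i = Z j" for i j
  proof (rule card_subset_eq[OF finite_Z push_Z])
    show "card (push i ` Z i) = card (Z j)"
      unfolding card_image[OF inj] by (intro le_antisym card_le)
  qed
  have Z_const: "Z i = Z j" for i j
    using push_eq[of i i] push_eq[of i j] by simp
  show thesis
  proof (rule that[of "Z i\<^sub>1"])
    have "V\<^sub>1 \<in> Z i\<^sub>1"
      using K1 letter_prob_pos[of i\<^sub>1] by (simp add: Z_def K_def c_def ratio_def)
    then show "Z i\<^sub>1 \<noteq> {}" by blast
    show "push i ` Z i\<^sub>1 = Z i\<^sub>1" for i
      using push_eq[of i i\<^sub>1] Z_const[of i i\<^sub>1] by simp
    show "finite (Z i\<^sub>1)" by (rule finite_Z)
    show "Z i\<^sub>1 \<subseteq> \<S>" by (auto simp: Z_def)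
    show "mass V > 0" if "V \<in> Z i\<^sub>1" for V
    proof -
      have "0 < mass_on i\<^sub>1 V"
        using that c \<epsilon> letter_prob_pos[of i\<^sub>1] by (simp add: Z_def)
      also have "\<dots> \<le> mass V"
        using that by (intro mass_on_le_mass subspace_\<S>) (simp add: Z_def)
      finally show ?thesis .
    qed
  qed
qed

end

section \<open>No subspace is charged\<close>

context disintegrated_system
begin

lemma cocycle_image_Union:
  assumes "\<And>i. push i ` Z = Z"
  shows "(\<lambda>x. cocycle M n \<omega> *v x) ` \<Union>Z = \<Union>Z"
proof (induction n)
  case (Suc n)
  have "(\<lambda>x. cocycle M (Suc n) \<omega> *v x) ` \<Union>Z =
      (*v) (M ((shift ^^ n) \<omega>)) ` (\<lambda>x. cocycle M n \<omega> *v x) ` \<Union>Z"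
    by (simp add: image_image matrix_vector_mul_assoc)
  also have "\<dots> = (*v) (generator ((shift ^^ n) \<omega> 0)) ` \<Union>Z"
    by (simp only: Suc M_eq_generator)
  also have "\<dots> = \<Union>(push ((shift ^^ n) \<omega> 0) ` Z)"
    by blast
  also have "\<dots> = \<Union>Z"
    by (simp only: assms)
  finally show ?case .
qed simp

text \<open>Minimality of the dimension \<open>l\<close> among charged subspaces sets up \<open>exists_invariant_family\<close>. The
  family consists of charged subspaces, hence of nonzero ones, and of subspaces no larger than \<open>H\<close>,
  hence of proper ones.\<close>

theorem mass_eq_0:
  assumes irred: "strongly_irreducible M" and H: "subspace H" "H \<noteq> UNIV"
  shows "mass H = 0"
proof (rule ccontr)
  assume "mass H \<noteq> 0"
  then have H_charged: "mass H > 0"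
    using mass_nonneg[of H] by simp
  let ?charged = "\<lambda>n. \<exists>V. subspace V \<and> dim V = n \<and> mass V > 0"
  define l where "l = (LEAST n. ?charged n)"
  have "?charged l"
    unfolding l_def by (rule LeastI[of ?charged "dim H"]) (use H H_charged in blast)
  then obtain V\<^sub>0 where V\<^sub>0: "V\<^sub>0 \<in> subspaces_of_dim l" "mass V\<^sub>0 > 0"
    by (auto simp: subspaces_of_dim_def)
  have "l \<le> dim H"
    unfolding l_def by (rule Least_le) (use H H_charged in blast)
  interpret minimal_charged_dimension P M \<nu> \<kappa> l
  proof
    fix V :: "(real ^ 'd) set" assume "subspace V" "dim V < l"
    then have "\<not> mass V > 0"
      using not_less_Least[of "dim V" ?charged] by (auto simp: l_def)
    with mass_nonneg[of V] show "mass V = 0" by simp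
  qed
  obtain Z where Z: "finite Z" "Z \<noteq> {}" "Z \<subseteq> subspaces_of_dim l" "\<And>V. V \<in> Z \<Longrightarrow> mass V > 0"
    "\<And>i. push i ` Z = Z"
    using exists_invariant_family[OF V\<^sub>0] by blast
  have nontrivial: "\<forall>V\<in>Z. subspace V \<and> V \<noteq> {0} \<and> V \<noteq> UNIV"
  proof (intro ballI conjI)
    fix V assume V: "V \<in> Z"
    show "subspace V"
      using V Z(3) by (auto simp: subspaces_of_dim_def)
    show "V \<noteq> {0}"
    proof
      assume "V = {0}"
      then have "lines_in V = {}" by (simp add: lines_in_dim_0)
      with Z(4)[OF V] show False by (simp add: mass_def fibre_mass_def)
    qed
    have "dim V \<le> dim H"
      using V Z(3) \<open>l \<le> dim H\<close> by (auto simp: subspaces_of_dim_def)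
    then show "V \<noteq> UNIV"
      using H subspace_dim_equal[of H UNIV] by auto
  qed
  have "\<forall>A\<in>cocycle_matrices M. (\<lambda>x. A *v x) ` \<Union>Z = \<Union>Z"
  proof
    fix A assume "A \<in> cocycle_matrices M"
    then obtain n \<omega> where "A = cocycle M n \<omega>"
      by (auto simp: cocycle_matrices_def)
    then show "(\<lambda>x. A *v x) ` \<Union>Z = \<Union>Z"
      by (simp only: cocycle_image_Union[OF Z(5)])
  qed
  with Z(1,2) nontrivial have "\<exists>\<V>::(real ^ 'd) set set. finite \<V> \<and> \<V> \<noteq> {} \<and>
      (\<forall>V\<in>\<V>. subspace V \<and> V \<noteq> {0} \<and> V \<noteq> UNIV) \<and>
      (\<forall>A\<in>cocycle_matrices M. (\<lambda>x. A *v x) ` (\<Union>\<V>) = \<Union>\<V>)"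
    by (intro exI[of _ Z] conjI)
  with irred show False
    unfolding strongly_irreducible_def by (rule notE)
qed

end

theorem proposition3p6:
  fixes P :: "(nat \<Rightarrow> 'k::finite) measure"
    and M :: "(nat \<Rightarrow> 'k) \<Rightarrow> real ^ 'd ^ 'd::finite"
    and \<nu> :: "((nat \<Rightarrow> 'k) \<times> (real ^ 'd) set) measure"
  assumes "markovian_full_shift P"
    and "\<And>\<omega> \<omega>'. \<omega> 0 = \<omega>' 0 \<Longrightarrow> M \<omega> = M \<omega>'"
    and "spatially_invertible M"
    and "strongly_irreducible M"
    and "invariant_measure P M \<nu>"
  shows "proper P \<nu>"
  unfolding proper_def
proof (intro allI impI)
  fix \<kappa> and H :: "(real ^ 'd) set"
  assume \<kappa>: "factorisation P \<nu> \<kappa>" and H: "subspace H \<and> dim H + 1 = CARD('d)"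
  interpret disintegrated_system P M \<nu> \<kappa>
    by (intro disintegrated_system.intro markov_shift.intro disintegrated_system_axioms.intro
        assms(1,3,5) \<kappa>) (rule assms(2))
  have "H \<noteq> UNIV"
    using H by auto
  then have "mass H = 0"
    using mass_eq_0 assms(4) H by blast
  then show "(\<integral>\<^sup>+\<omega>. emeasure (\<kappa> \<omega>) (lines_in H) \<partial>P) = 0"
    using nn_integral_fibre_mass[of H] H by (simp add: emeasure_kernel_lines)
qed

end
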